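(* Let $r>0$, $\rho\ge 0$, $\sigma>0$, $c>0$. Let $\nu$ be a Lévy measure on $\mathbb{R}_0=\mathbb{R}\setminus\{0\}$ with finite large-jump intensity $\lambda:=\nu(\{|z|>1\})<\infty$, and let $\gamma$ be an admissible jump amplitude with constant $L_\gamma>0$ such that $$r+\rho<\sqrt{\lambda}\,L_\gamma,$$ and set $\beta:=\sqrt{\lambda}\,L_\gamma-(r+\rho)>0$. Then, for every finite horizon $T>0$ (and time profile $\alpha$ on $[0,T]$ satisfying the standing assumptions of the context), there exists a nonnegative (global, i.e. on all of $\mathbb{R}\times[0,T]$) viscosity supersolution $$v^T:\mathbb{R}\times[0,T]\to[0,\infty)$$ of the obstacle PIDE $$\min\left(-\mathcal{L}^{\nu}u(g,t),\ u(g,t)-u(-g,t)-\psi(g,t)\right)=0,\qquad (g,t)\in\mathbb{R}\times[0,T).$$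
   Context: Standing assumptions on the time profile: $\alpha\in C^1([0,T])$, $\alpha(t)\ge 0$ for all $t\in[0,T]$, $\alpha\not\equiv 0$, $\alpha(T)=0$, and $\alpha'(t)\le 0$ for all $t$. The payoff is $\psi(g,t):=g\,\alpha(t)-c$. Lévy measure: a Borel measure $\nu$ on $\mathbb{R}_0=\mathbb{R}\setminus\{0\}$ with $\int_{\mathbb{R}_0}\min(1,z^2)\,\nu(dz)<\infty$. Admissible jump amplitude: $\gamma:\mathbb{R}\times\mathbb{R}_0\to\mathbb{R}$ is admissible (with constant $L_\gamma>0$) if (1) for every $g\in\mathbb{R}$ the map $z\mapsto\gamma(g,z)$ is Borel measurable on $\mathbb{R}_0$, and for every $z\in\mathbb{R}_0$ the map $g\mapsto\gamma(g,z)$ is continuous; (2) $\int_{\mathbb{R}_0}|\gamma(x,z)-\gamma(y,z)|^2\,\nu(dz)\le L_\gamma^2|x-y|^2$ for all $x,y\in\mathbb{R}$, and $\int_{\mathbb{R}_0}|\gamma(0,z)|^2\,\nu(dz)<\infty$; (3) there is $K_1>0$ with $\sup_{0<|z|\le 1}\frac{|\gamma(g,z)|}{|z|}\le K_1(1+|g|)$ for all $g\in\mathbb{R}$; (4) there is $\epsilon\in(0,1)$ with $\limsup_{|g|\to\infty}\sup_{0<|z|\le1}\frac{|\gamma(g,z)|}{|g|}\le 1-\epsilon$. Operator (for sufficiently smooth $w$): $$\mathcal{L}^{\nu}w=w_t-\rho g\,w_g+\frac{\sigma^2}{2}w_{gg}+\int_{\mathbb{R}_0}\left[w(g+\gamma(g,z),t)-w(g,t)-\gamma(g,z)w_g(g,t)\mathbf{1}_{\{|z|\le1\}}\right]\nu(dz)-rw.$$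 Split test operator: for $\delta\in(0,1)$, $\varphi\in C^{2,1}(\mathbb{R}\times[0,T))$ ($C^2$ in $g$, $C^1$ in $t$) and a function $w$, set $$\mathcal{I}^{1,\delta}[\varphi](g,t):=\int_{0<|z|\le\delta}\left[\varphi(g+\gamma(g,z),t)-\varphi(g,t)-\gamma(g,z)\varphi_g(g,t)\right]\nu(dz),$$ $$\mathcal{I}^{2,\delta}[w,\varphi](g,t):=\int_{|z|>\delta}\left[w(g+\gamma(g,z),t)-w(g,t)-\gamma(g,z)\varphi_g(g,t)\mathbf{1}_{\{|z|\le1\}}\right]\nu(dz),$$ $$\mathcal{L}^{\nu,\delta}[\varphi,w](g,t):=\varphi_t-\rho g\,\varphi_g+\frac{\sigma^2}{2}\varphi_{gg}-r\,w(g,t)+\mathcal{I}^{1,\delta}[\varphi](g,t)+\mathcal{I}^{2,\delta}[w,\varphi](g,t).$$ Viscosity supersolution: a lower semicontinuous $v:\mathbb{R}\times[0,T]\to\mathbb{R}$ with linear growth (there is $C>0$ with $|v(g,t)|\le C(|g|+1)$ on $\mathbb{R}\times[0,T]$) is a viscosity supersolution of the obstacle problem (with terminal condition $u(\cdot,T)=0$) if $v(g,T)\ge 0$ for all $g\in\mathbb{R}$ and, whenever $\varphi\in C^{2,1}(\mathbb{R}\times[0,T))$ is such that $v-\varphi$ attains a global minimum at $(g_0,t_0)\in\mathbb{R}\times[0,T)$ with $v(g_0,t_0)=\varphi(g_0,t_0)$, one has for every $\delta\in(0,1)$ $$\min\left\{-\mathcal{L}^{\nu,\delta}[\varphi,v](g_0,t_0),\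 v(g_0,t_0)-v(-g_0,t_0)-\psi(g_0,t_0)\right\}\ge 0.$$ *)

theory Defs
  imports "HOL-Analysis.Analysis"
begin

definition time_profile :: "real \<Rightarrow> (real \<Rightarrow> real) \<Rightarrow> bool" where
  "time_profile T \<alpha> \<longleftrightarrow>
     (\<exists>\<alpha>'. continuous_on {0..T} \<alpha>' \<and>
       (\<forall>t\<in>{0..T}. (\<alpha> has_real_derivative \<alpha>' t) (at t within {0..T}) \<and> \<alpha>' t \<le> 0)) \<and>
     (\<forall>t\<in>{0..T}. 0 \<le> \<alpha> t) \<and>
     (\<exists>t\<in>{0..T}. \<alpha> t \<noteq> 0) \<and>
     \<alpha> T = 0"

definition payoff :: "real \<Rightarrow> (real \<Rightarrow> real) \<Rightarrow> real \<Rightarrow> real \<Rightarrow> real" where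
  "payoff c \<alpha> g t = g * \<alpha> t - c"

text \<open>The underlying space of a Levy measure is the punctured line, so \<open>0\<close> is not in
  \<open>space \<nu>\<close>. Accordingly a jump amplitude \<open>\<gamma> g z\<close> is only constrained for \<open>z \<noteq> 0\<close>.\<close>

definition levy_measure :: "real measure \<Rightarrow> bool" where
  "levy_measure \<nu> \<longleftrightarrow>
     space \<nu> = - {0} \<and>
     sets \<nu> = sets (restrict_space borel (- {0})) \<and>
     (\<integral>\<^sup>+ z. ennreal (min 1 (z\<^sup>2)) \<partial>\<nu>) < \<infinity>"

text \<open>Suprema and the upper limit are taken in the extended reals, where they always exist.\<close>

definition admissible_jump :: "real measure \<Rightarrow> real \<Rightarrow> (real \<Rightarrow> real \<Rightarrow> real) \<Rightarrow> bool" where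
  "admissible_jump \<nu> L \<gamma> \<longleftrightarrow>
     0 < L \<and>
     (\<forall>g. (\<lambda>z. \<gamma> g z) \<in> borel_measurable (restrict_space borel (- {0}))) \<and>
     (\<forall>z. z \<noteq> 0 \<longrightarrow> continuous_on UNIV (\<lambda>g. \<gamma> g z)) \<and>
     (\<forall>x y. (\<integral>\<^sup>+ z. ennreal (\<bar>\<gamma> x z - \<gamma> y z\<bar>\<^sup>2) \<partial>\<nu>) \<le> ennreal (L\<^sup>2 * \<bar>x - y\<bar>\<^sup>2)) \<and>
     (\<integral>\<^sup>+ z. ennreal (\<bar>\<gamma> 0 z\<bar>\<^sup>2) \<partial>\<nu>) < \<infinity> \<and>
     (\<exists>K>0. \<forall>g. (SUP z\<in>{z. 0 < \<bar>z\<bar> \<and> \<bar>z\<bar> \<le> 1}. ereal (\<bar>\<gamma> g z\<bar> / \<bar>z\<bar>)) \<le> ereal (K * (1 + \<bar>g\<bar>))) \<and>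
     (\<exists>\<epsilon>. 0 < \<epsilon> \<and> \<epsilon> < 1 \<and>
       Limsup at_infinity (\<lambda>g. SUP z\<in>{z. 0 < \<bar>z\<bar> \<and> \<bar>z\<bar> \<le> 1}. ereal (\<bar>\<gamma> g z\<bar> / \<bar>g\<bar>))
         \<le> ereal (1 - \<epsilon>))"

text \<open>\<open>C21 T \<phi> \<phi>t \<phi>g \<phi>gg\<close>: \<open>\<phi>\<close> is of class \<open>C\<^sup>2\<close> in space and \<open>C\<^sup>1\<close> in time on
  \<open>\<real> \<times> [0,T)\<close>, with the given partial derivatives (which are determined by \<open>\<phi>\<close> on that set);
  the time derivative at \<open>t = 0\<close> is one-sided.\<close>

definition C21 :: "real \<Rightarrow> (real \<Rightarrow> real \<Rightarrow> real) \<Rightarrow> (real \<Rightarrow> real \<Rightarrow> real) \<Rightarrow>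
    (real \<Rightarrow> real \<Rightarrow> real) \<Rightarrow> (real \<Rightarrow> real \<Rightarrow> real) \<Rightarrow> bool" where
  "C21 T \<phi> \<phi>t \<phi>g \<phi>gg \<longleftrightarrow>
     (\<forall>g. \<forall>t\<in>{0..<T}.
       ((\<lambda>s. \<phi> g s) has_real_derivative \<phi>t g t) (at t within {0..<T}) \<and>
       ((\<lambda>x. \<phi> x t) has_real_derivative \<phi>g g t) (at g) \<and>
       ((\<lambda>x. \<phi>g x t) has_real_derivative \<phi>gg g t) (at g)) \<and>
     continuous_on (UNIV \<times> {0..<T}) (\<lambda>(g, t). \<phi> g t) \<and>
     continuous_on (UNIV \<times> {0..<T}) (\<lambda>(g, t). \<phi>t g t) \<and>
     continuous_on (UNIV \<times> {0..<T}) (\<lambda>(g, t). \<phi>g g t) \<and>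
     continuous_on (UNIV \<times> {0..<T}) (\<lambda>(g, t). \<phi>gg g t)"

definition I1 :: "real measure \<Rightarrow> (real \<Rightarrow> real \<Rightarrow> real) \<Rightarrow> real \<Rightarrow>
    (real \<Rightarrow> real \<Rightarrow> real) \<Rightarrow> (real \<Rightarrow> real \<Rightarrow> real) \<Rightarrow> real \<Rightarrow> real \<Rightarrow> real" where
  "I1 \<nu> \<gamma> \<delta> \<phi> \<phi>g g t =
     (LINT z:{z. 0 < \<bar>z\<bar> \<and> \<bar>z\<bar> \<le> \<delta>}|\<nu>.
        \<phi> (g + \<gamma> g z) t - \<phi> g t - \<gamma> g z * \<phi>g g t)"

definition I2 :: "real measure \<Rightarrow> (real \<Rightarrow> real \<Rightarrow> real) \<Rightarrow> real \<Rightarrow>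
    (real \<Rightarrow> real \<Rightarrow> real) \<Rightarrow> (real \<Rightarrow> real \<Rightarrow> real) \<Rightarrow> real \<Rightarrow> real \<Rightarrow> real" where
  "I2 \<nu> \<gamma> \<delta> w \<phi>g g t =
     (LINT z:{z. \<bar>z\<bar> > \<delta>}|\<nu>.
        w (g + \<gamma> g z) t - w g t - \<gamma> g z * \<phi>g g t * indicator {z. \<bar>z\<bar> \<le> 1} z)"

text \<open>The split operator applied to a test function \<open>\<phi>\<close>, with its partial derivatives as
  further arguments, and to \<open>w\<close>.\<close>

definition split_op :: "real \<Rightarrow> real \<Rightarrow> real \<Rightarrow> real measure \<Rightarrow> (real \<Rightarrow> real \<Rightarrow> real) \<Rightarrow> real \<Rightarrow>
    (real \<Rightarrow> real \<Rightarrow> real) \<Rightarrow> (real \<Rightarrow> real \<Rightarrow> real) \<Rightarrow> (real \<Rightarrow> real \<Rightarrow> real) \<Rightarrow>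
    (real \<Rightarrow> real \<Rightarrow> real) \<Rightarrow> (real \<Rightarrow> real \<Rightarrow> real) \<Rightarrow> real \<Rightarrow> real \<Rightarrow> real" where
  "split_op r \<rho> \<sigma> \<nu> \<gamma> \<delta> \<phi> \<phi>t \<phi>g \<phi>gg w g t =
     \<phi>t g t - \<rho> * g * \<phi>g g t + \<sigma>\<^sup>2 / 2 * \<phi>gg g t - r * w g t
       + I1 \<nu> \<gamma> \<delta> \<phi> \<phi>g g t + I2 \<nu> \<gamma> \<delta> w \<phi>g g t"

definition lsc_on :: "'a::topological_space set \<Rightarrow> ('a \<Rightarrow> real) \<Rightarrow> bool" where
  "lsc_on S f \<longleftrightarrow> (\<forall>x\<in>S. \<forall>y. y < f x \<longrightarrow> (\<forall>\<^sub>F x' in at x within S. y < f x'))"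

text \<open>Functions on \<open>\<real> \<times> [0,T]\<close> are total functions of which only the values on that set matter.\<close>

definition viscosity_supersolution :: "real \<Rightarrow> real \<Rightarrow> real \<Rightarrow> real \<Rightarrow> real measure \<Rightarrow>
    (real \<Rightarrow> real \<Rightarrow> real) \<Rightarrow> (real \<Rightarrow> real) \<Rightarrow> real \<Rightarrow> (real \<Rightarrow> real \<Rightarrow> real) \<Rightarrow> bool" where
  "viscosity_supersolution r \<rho> \<sigma> c \<nu> \<gamma> \<alpha> T v \<longleftrightarrow>
     lsc_on (UNIV \<times> {0..T}) (\<lambda>(g, t). v g t) \<and>
     (\<exists>C>0. \<forall>g. \<forall>t\<in>{0..T}. \<bar>v g t\<bar> \<le> C * (\<bar>g\<bar> + 1)) \<and>
     (\<forall>g. 0 \<le> v g T) \<and>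
     (\<forall>\<phi> \<phi>t \<phi>g \<phi>gg. C21 T \<phi> \<phi>t \<phi>g \<phi>gg \<longrightarrow>
       (\<forall>g0. \<forall>t0\<in>{0..<T}.
         (\<forall>g. \<forall>t\<in>{0..<T}. v g0 t0 - \<phi> g0 t0 \<le> v g t - \<phi> g t) \<and> v g0 t0 = \<phi> g0 t0 \<longrightarrow>
         (\<forall>\<delta>. 0 < \<delta> \<and> \<delta> < 1 \<longrightarrow>
           min (- split_op r \<rho> \<sigma> \<nu> \<gamma> \<delta> \<phi> \<phi>t \<phi>g \<phi>gg v g0 t0)
               (v g0 t0 - v (- g0) t0 - payoff c \<alpha> g0 t0) \<ge> 0)))"

end

theory Submission
  imports Defs
begin

text \<open>
  The supersolution is explicit and smooth in space. The obstacle condition only sees the part of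
  \<open>v\<close> that is odd in \<open>g\<close>, and it holds with slack \<open>c\<close> as soon as this odd part is
  \<open>\<alpha>(t) g / 2\<close>. The even part can then be any multiple of \<open>\<langle>g\<rangle> = sqrt (1 + g\<^sup>2)\<close> that grows fast
  enough backwards in time, so the candidate is

    \<open>v(g,t) = M(t) \<langle>g\<rangle> + \<alpha>(t) g / 2\<close> with \<open>M(t) = M\<^sub>0 exp (B (T - t))\<close>.

  For \<open>M\<^sub>0\<close> at least \<open>sup \<bar>\<alpha>\<bar>\<close> the even part dominates the odd one, which gives \<open>v \<ge> 0\<close>. The smooth
  bracket is used instead of \<open>\<bar>g\<bar>\<close> or the positive part of \<open>g\<close>, because a convex kink can be touched
  from below by test functions with arbitrarily large second derivative and hence
  violates the supersolution inequality when \<open>\<sigma> > 0\<close>.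

  A test function touching \<open>v\<close> from below has the same slope, at most the same second derivative
  and, because comparing with later times is enough for this, at most the same time derivative as \<open>v\<close>. So it suffices
  that every term of the operator applied to \<open>v\<close>, apart from the contribution \<open>M'(t) \<langle>g\<rangle> = - B M(t) \<langle>g\<rangle>\<close>
  of the exponential, is bounded above by a constant multiple of \<open>M(t) \<langle>g\<rangle>\<close>; a large \<open>B\<close> then wins.

  Only the jumps need care: the second moment \<open>\<integral> \<gamma>(g,z)\<^sup>2 \<nu>(dz)\<close> grows quadratically in \<open>g\<close>
  (\<open>admissible_jump_second_moment\<close>), whereas linear growth is required. What saves a power of \<open>g\<close>
  is that the compensated increment of the bracket satisfies
  \<open>\<langle>g + h\<rangle> - \<langle>g\<rangle> - h g / \<langle>g\<rangle> \<le> h\<^sup>2 / (2 \<langle>g\<rangle>)\<close> for all \<open>h\<close>, however large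
  (\<open>jbracket_compensated_increment_le\<close>). For the uncompensated jumps, \<open>2 \<bar>h\<bar> \<le> h\<^sup>2 / \<langle>g\<rangle> + \<langle>g\<rangle>\<close> brings in
  the same quotient, and the remaining \<open>\<langle>g\<rangle>\<close> is integrated over a set of finite measure. Both bounds
  are combined in \<open>nonlocal_terms_le\<close>.
\<close>

section \<open>The bracket, a smooth version of the absolute value\<close>

definition jbracket :: "real \<Rightarrow> real" where
  "jbracket x = sqrt (1 + x\<^sup>2)"

lemma jbracket_ge_1: "1 \<le> jbracket x"
  by (simp add: jbracket_def)

lemma jbracket_pos [simp]: "0 < jbracket x" "jbracket x \<noteq> 0"
  using jbracket_ge_1[of x] by auto

lemma jbracket_square: "(jbracket x)\<^sup>2 = 1 + x\<^sup>2"
  by (simp add: jbracket_def)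

lemma jbracket_minus: "jbracket (- x) = jbracket x"
  by (simp add: jbracket_def)

lemma abs_le_jbracket: "\<bar>x\<bar> \<le> jbracket x"
  unfolding jbracket_def by (rule real_le_rsqrt) simp

lemma jbracket_le: "jbracket x \<le> \<bar>x\<bar> + 1"
  unfolding jbracket_def by (rule real_le_lsqrt) (auto simp: power2_sum)

lemma jbracket_has_derivative: "(jbracket has_real_derivative x / jbracket x) (at x)"
proof -
  have "0 < 1 + x\<^sup>2" by (simp add: add_pos_nonneg)
  then show ?thesis
    unfolding jbracket_def by (auto intro!: derivative_eq_intros simp: field_simps)
qed

lemma jbracket_has_second_derivative:
  "((\<lambda>x. x / jbracket x) has_real_derivative 1 / jbracket x ^ 3) (at x)"
proof -
  have "((\<lambda>x. x / jbracket x) has_real_derivative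
      (1 * jbracket x - x * (x / jbracket x)) / (jbracket x * jbracket x)) (at x)"
    by (intro DERIV_divide DERIV_ident jbracket_has_derivative) simp
  moreover have "(1 * jbracket x - x * (x / jbracket x)) / (jbracket x * jbracket x)
      = ((jbracket x)\<^sup>2 - x\<^sup>2) / jbracket x ^ 3"
    by (simp add: field_simps power2_eq_square power3_eq_cube)
  ultimately show ?thesis by (simp add: jbracket_square)
qed

text \<open>The square root lies below its tangent: by AM-GM, \<open>2 \<langle>x\<rangle> \<langle>x + h\<rangle> \<le> \<langle>x\<rangle>\<^sup>2 + \<langle>x + h\<rangle>\<^sup>2\<close>, and the right
  side is a quadratic polynomial in \<open>h\<close>. A Taylor expansion would instead bring in the second
  derivative of the bracket at an intermediate point, where it need not be of order \<open>1 / \<langle>x\<rangle>\<close>.\<close>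
lemma jbracket_compensated_increment_le:
  "jbracket (x + h) - jbracket x - h * (x / jbracket x) \<le> h\<^sup>2 / (2 * jbracket x)"
proof -
  have "0 \<le> (jbracket (x + h) - jbracket x)\<^sup>2" by simp
  then have "2 * jbracket x * jbracket (x + h) \<le> 2 * (1 + x\<^sup>2) + 2 * h * x + h\<^sup>2"
    unfolding power2_diff jbracket_square by (simp add: power2_sum algebra_simps)
  then have "(jbracket (x + h) - jbracket x - h * (x / jbracket x)) * (2 * jbracket x) \<le> h\<^sup>2"
    using jbracket_square[of x] by (simp add: algebra_simps power2_eq_square)
  then show ?thesis by (simp add: pos_le_divide_eq)
qed

lemma jbracket_increment_le: "jbracket (x + h) - jbracket x \<le> \<bar>h\<bar>"
proof -
  have "x * h \<le> jbracket x * \<bar>h\<bar>"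
    using mult_right_mono[OF abs_le_jbracket[of x], of "\<bar>h\<bar>"]
      abs_ge_self[of "x * h"] by (simp add: abs_mult)
  then have "1 + (x + h)\<^sup>2 \<le> (jbracket x + \<bar>h\<bar>)\<^sup>2"
    by (simp add: power2_sum jbracket_square)
  then have "jbracket (x + h) \<le> jbracket x + \<bar>h\<bar>"
    unfolding jbracket_def[of "x + h"] by (intro real_le_lsqrt add_nonneg_nonneg) (auto simp: less_imp_le)
  then show ?thesis by simp
qed

text \<open>Pointwise substitute for the Cauchy-Schwarz inequality: integrated over the large jumps, it
  bounds a first moment by a quadratically growing second moment divided by \<open>\<langle>g\<rangle>\<close>, that is, linearly.\<close>
lemma two_abs_le_jbracket: "2 * \<bar>h\<bar> \<le> h\<^sup>2 / jbracket g + jbracket g"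
proof -
  have "0 \<le> (\<bar>h\<bar> - jbracket g)\<^sup>2" by simp
  then show ?thesis by (simp add: power2_diff field_simps power2_eq_square)
qed

section \<open>Second moments of the jump amplitude\<close>

lemma large_jumps_measurable:
  assumes "levy_measure \<nu>"
  shows "{z. \<bar>z\<bar> > 1} \<in> sets \<nu>"
proof -
  have "{z::real. \<bar>z\<bar> > 1} \<in> sets borel"
    using borel_open[of "{z::real. \<bar>z\<bar> > 1}"] by (simp add: open_Collect_less continuous_intros)
  moreover have "{z. \<bar>z\<bar> > 1} = - {0} \<inter> {z::real. \<bar>z\<bar> > 1}" by auto
  ultimately show ?thesis
    using assms unfolding levy_measure_def by (auto simp: sets_restrict_space)
qed

text \<open>From \<open>\<gamma> g = (\<gamma> g - \<gamma> 0) + \<gamma> 0\<close>: the first summand is controlled by the Lipschitz condition in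
  \<open>L\<^sup>2(\<nu>)\<close>, the second by the integrability at \<open>0\<close>.\<close>
lemma admissible_jump_second_moment:
  assumes "levy_measure \<nu>" and adm: "admissible_jump \<nu> L \<gamma>"
  obtains C where "0 \<le> C"
    and "\<And>g. integrable \<nu> (\<lambda>z. (\<gamma> g z)\<^sup>2)"
    and "\<And>g. (LINT z|\<nu>. (\<gamma> g z)\<^sup>2) \<le> C * (1 + g\<^sup>2)"
proof -
  have meas [measurable]: "\<gamma> g \<in> borel_measurable \<nu>" for g
    using assms unfolding levy_measure_def admissible_jump_def
    by (metis measurable_cong_sets)
  have lip: "(\<integral>\<^sup>+ z. ennreal ((\<gamma> x z - \<gamma> y z)\<^sup>2) \<partial>\<nu>) \<le> ennreal (L\<^sup>2 * (x - y)\<^sup>2)" for x y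
    using adm unfolding admissible_jump_def by simp
  have int0: "integrable \<nu> (\<lambda>z. (\<gamma> 0 z)\<^sup>2)"
    using adm unfolding admissible_jump_def by (intro integrableI_nonneg) auto
  have intd: "integrable \<nu> (\<lambda>z. (\<gamma> g z - \<gamma> 0 z)\<^sup>2)" for g
    by (rule integrableI_nonneg) (auto intro!: le_less_trans[OF lip])
  have bd: "(LINT z|\<nu>. (\<gamma> g z - \<gamma> 0 z)\<^sup>2) \<le> L\<^sup>2 * g\<^sup>2" for g
    using lip[of g 0] by (subst integral_eq_nn_integral) (auto intro!: enn2real_leI)
  have dom: "(\<gamma> g z)\<^sup>2 \<le> 2 * (\<gamma> g z - \<gamma> 0 z)\<^sup>2 + 2 * (\<gamma> 0 z)\<^sup>2" for g z
  proof -
    have "0 \<le> (\<gamma> g z - 2 * \<gamma> 0 z)\<^sup>2" by simp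
    then show ?thesis by (simp add: power2_eq_square algebra_simps)
  qed
  have intdom: "integrable \<nu> (\<lambda>z. 2 * (\<gamma> g z - \<gamma> 0 z)\<^sup>2 + 2 * (\<gamma> 0 z)\<^sup>2)" for g
    using int0 intd by auto
  define m where "m = (LINT z|\<nu>. (\<gamma> 0 z)\<^sup>2)"
  have m: "0 \<le> m" unfolding m_def by simp
  show ?thesis
  proof
    show "0 \<le> 2 * L\<^sup>2 + 2 * m" using m by simp
    show int: "integrable \<nu> (\<lambda>z. (\<gamma> g z)\<^sup>2)" for g
      by (rule Bochner_Integration.integrable_bound[OF intdom[of g]])
        (use dom in \<open>auto intro: order.trans\<close>)
    show "(LINT z|\<nu>. (\<gamma> g z)\<^sup>2) \<le> (2 * L\<^sup>2 + 2 * m) * (1 + g\<^sup>2)" for g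
    proof -
      have "(LINT z|\<nu>. (\<gamma> g z)\<^sup>2) \<le> (LINT z|\<nu>. 2 * (\<gamma> g z - \<gamma> 0 z)\<^sup>2 + 2 * (\<gamma> 0 z)\<^sup>2)"
        by (intro integral_mono int intdom dom)
      also have "\<dots> = 2 * (LINT z|\<nu>. (\<gamma> g z - \<gamma> 0 z)\<^sup>2) + 2 * m"
        using int0 intd by (simp add: m_def)
      also have "\<dots> \<le> 2 * (L\<^sup>2 * g\<^sup>2) + 2 * m" using bd[of g] by simp
      also have "\<dots> \<le> (2 * L\<^sup>2 + 2 * m) * (1 + g\<^sup>2)"
        using m by (simp add: algebra_simps)
      finally show ?thesis .
    qed
  qed
qed

section \<open>Derivatives at a minimum\<close>

text \<open>The point \<open>a = 0\<close> is included: as the interval is half-open, there is always room to the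
  right of \<open>a\<close>, and that side alone determines the sign.\<close>
lemma right_derivative_nonneg_at_min:
  fixes f :: "real \<Rightarrow> real"
  assumes der: "(f has_real_derivative l) (at a within {0..<T})"
    and a: "a \<in> {0..<T}" and min: "\<And>t. t \<in> {0..<T} \<Longrightarrow> f a \<le> f t"
  shows "0 \<le> l"
proof (rule ccontr)
  assume "\<not> 0 \<le> l"
  then obtain d where d: "d > 0"
    "\<And>h. 0 < h \<Longrightarrow> a + h \<in> {0..<T} \<Longrightarrow> h < d \<Longrightarrow> f (a + h) < f a"
    using has_real_derivative_neg_dec_right[OF der] by (auto simp: not_le)
  define h where "h = min (d / 2) ((T - a) / 2)"
  have "0 < h" "h < d" "h < T - a" using d(1) a by (auto simp: h_def min_def)
  then show False using d(2)[of h] min[of "a + h"] a by fastforce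
qed

lemma second_derivative_nonneg_at_min:
  fixes f f' :: "real \<Rightarrow> real"
  assumes der: "\<And>x. (f has_real_derivative f' x) (at x)"
    and der2: "(f' has_real_derivative l) (at a)"
    and min: "\<And>x. f a \<le> f x"
  shows "0 \<le> l"
proof (rule ccontr)
  have crit: "f' a = 0" using DERIV_local_min[OF der, of 1 a] min by auto
  assume "\<not> 0 \<le> l"
  then obtain d where d: "d > 0" "\<And>h. 0 < h \<Longrightarrow> h < d \<Longrightarrow> f' (a + h) < f' a"
    using DERIV_neg_dec_right[OF der2] by (auto simp: not_le)
  obtain z where z: "a < z" "z < a + d / 2" "f (a + d / 2) - f a = (a + d / 2 - a) * f' z"
    using MVT2[of a "a + d / 2" f f'] der d(1) by auto
  have "f' z < 0" using d(2)[of "z - a"] z crit d(1) by auto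
  then have "(a + d / 2 - a) * f' z < 0" using d(1) by (simp add: mult_pos_neg)
  then show False using z min[of "a + d / 2"] by linarith
qed

section \<open>The barrier\<close>

text \<open>The candidate supersolution at one instant, with \<open>M\<close> and \<open>a\<close> standing for the values of the
  two time-dependent coefficients.\<close>
definition barrier :: "real \<Rightarrow> real \<Rightarrow> real \<Rightarrow> real" where
  "barrier M a g = M * jbracket g + a / 2 * g"

lemma barrier_nonneg:
  assumes "\<bar>a\<bar> / 2 \<le> M"
  shows "0 \<le> barrier M a g"
proof -
  have "\<bar>a / 2 * g\<bar> \<le> M * jbracket g"
    unfolding abs_mult using assms by (intro mult_mono abs_le_jbracket) auto
  then show ?thesis unfolding barrier_def by linarith
qed

lemma barrier_le:
  assumes "\<bar>a\<bar> / 2 \<le> M"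
  shows "barrier M a g \<le> 2 * M * (\<bar>g\<bar> + 1)"
proof -
  have "M * jbracket g \<le> M * (\<bar>g\<bar> + 1)" using assms by (intro mult_left_mono jbracket_le) auto
  moreover have "a / 2 * g \<le> M * (\<bar>g\<bar> + 1)"
  proof -
    have "\<bar>a / 2 * g\<bar> \<le> M * (\<bar>g\<bar> + 1)" unfolding abs_mult using assms by (intro mult_mono) auto
    then show ?thesis by linarith
  qed
  ultimately show ?thesis unfolding barrier_def by (simp add: algebra_simps)
qed

text \<open>Only the odd part survives, which makes the obstacle condition independent of \<open>M\<close>.\<close>
lemma barrier_reflection: "barrier M a g - barrier M a (- g) = g * a"
  by (simp add: barrier_def jbracket_minus)

lemma barrier_has_derivative:
  "(barrier M a has_real_derivative M * (g / jbracket g) + a / 2) (at g)"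
  unfolding barrier_def [abs_def]
  by (auto intro!: derivative_eq_intros jbracket_has_derivative)

lemma barrier_has_second_derivative:
  "((\<lambda>g. M * (g / jbracket g) + a / 2) has_real_derivative M * (1 / jbracket g ^ 3)) (at g)"
  using DERIV_add[OF DERIV_cmult[OF jbracket_has_second_derivative] DERIV_const] by simp

lemma barrier_compensated_increment_le:
  assumes "0 \<le> M"
  shows "barrier M a (g + h) - barrier M a g - h * (M * (g / jbracket g) + a / 2)
    \<le> M * (h\<^sup>2 / jbracket g)"
proof -
  have "barrier M a (g + h) - barrier M a g - h * (M * (g / jbracket g) + a / 2)
      = M * (jbracket (g + h) - jbracket g - h * (g / jbracket g))"
    unfolding barrier_def by (simp add: algebra_simps add_divide_distrib)
  also have "\<dots> \<le> M * (h\<^sup>2 / (2 * jbracket g))"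
    by (intro mult_left_mono jbracket_compensated_increment_le assms)
  also have "\<dots> \<le> M * (h\<^sup>2 / jbracket g)"
    by (intro mult_left_mono assms divide_left_mono) (auto simp: less_imp_le)
  finally show ?thesis .
qed

lemma barrier_increment_le:
  assumes "\<bar>a\<bar> / 2 \<le> M"
  shows "barrier M a (g + h) - barrier M a g \<le> M * (h\<^sup>2 / jbracket g + jbracket g)"
proof -
  have "barrier M a (g + h) - barrier M a g = M * (jbracket (g + h) - jbracket g) + a / 2 * h"
    unfolding barrier_def by (simp add: algebra_simps add_divide_distrib)
  also have "\<dots> \<le> M * \<bar>h\<bar> + M * \<bar>h\<bar>"
  proof (rule add_mono)
    show "M * (jbracket (g + h) - jbracket g) \<le> M * \<bar>h\<bar>"
      using assms by (intro mult_left_mono jbracket_increment_le) auto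
    have "\<bar>a / 2 * h\<bar> \<le> M * \<bar>h\<bar>" unfolding abs_mult using assms by (intro mult_right_mono) auto
    then show "a / 2 * h \<le> M * \<bar>h\<bar>" by linarith
  qed
  also have "\<dots> = M * (2 * \<bar>h\<bar>)" by simp
  also have "\<dots> \<le> M * (h\<^sup>2 / jbracket g + jbracket g)"
    using assms by (intro mult_left_mono two_abs_le_jbracket) auto
  finally show ?thesis .
qed

section \<open>The nonlocal terms\<close>

text \<open>Both integrands are dominated by the same nonnegative integrable function \<open>H\<close>, so both
  integrals are at most \<open>\<integral> H\<close>. A one-sided bound by such an \<open>H\<close> is enough even for an integrand
  that is not integrable, since its integral is \<open>0\<close> by convention.\<close>
lemma nonlocal_terms_le:
  assumes levy: "levy_measure \<nu>" and fin: "emeasure \<nu> {z. \<bar>z\<bar> > 1} < \<infinity>"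
    and adm: "admissible_jump \<nu> L \<gamma>"
  obtains C where "\<And>\<phi> \<phi>g v M a g t \<delta>.
    \<lbrakk>\<And>x. v x t = barrier M a x; \<And>x. \<phi> x t \<le> v x t; \<phi> g t = v g t;
     \<phi>g g t = M * (g / jbracket g) + a / 2; \<bar>a\<bar> / 2 \<le> M; 0 < \<delta>; \<delta> < 1\<rbrakk>
    \<Longrightarrow> I1 \<nu> \<gamma> \<delta> \<phi> \<phi>g g t + I2 \<nu> \<gamma> \<delta> v \<phi>g g t \<le> C * (M * jbracket g)"
proof -
  obtain C where C: "0 \<le> C" and int: "\<And>g. integrable \<nu> (\<lambda>z. (\<gamma> g z)\<^sup>2)"
    and bd: "\<And>g. (LINT z|\<nu>. (\<gamma> g z)\<^sup>2) \<le> C * (1 + g\<^sup>2)"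
    using admissible_jump_second_moment[OF levy adm] by blast
  define m where "m = measure \<nu> {z. \<bar>z\<bar> > 1}"
  have intI: "integrable \<nu> (indicator {z. \<bar>z\<bar> > 1} :: real \<Rightarrow> real)"
    using large_jumps_measurable[OF levy] fin by (simp add: integrable_real_indicator)
  have intI_eq: "(LINT z|\<nu>. indicator {z. \<bar>z\<bar> > 1} z) = m"
  proof -
    have "{z. \<bar>z\<bar> > 1} \<inter> space \<nu> = {z. \<bar>z\<bar> > 1}" using levy by (auto simp: levy_measure_def)
    then show ?thesis by (simp add: m_def)
  qed
  show ?thesis
  proof (rule that[of "2 * (C + m)"])
    fix \<phi> \<phi>g v :: "real \<Rightarrow> real \<Rightarrow> real" and M a g t \<delta> :: real
    assume v: "\<And>x. v x t = barrier M a x" and below: "\<And>x. \<phi> x t \<le> v x t"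
      and touch: "\<phi> g t = v g t" and slope: "\<phi>g g t = M * (g / jbracket g) + a / 2"
      and aM: "\<bar>a\<bar> / 2 \<le> M" and \<delta>: "0 < \<delta>" "\<delta> < 1"
    have M: "0 \<le> M" using aM by linarith
    define H where "H z = M * ((\<gamma> g z)\<^sup>2 / jbracket g) + M * jbracket g * indicator {z. \<bar>z\<bar> > 1} z"
      for z
    have H0: "0 \<le> H z" for z using M by (simp add: H_def less_imp_le)
    have intH: "integrable \<nu> H"
      unfolding H_def using int intI by (intro Bochner_Integration.integrable_add
        Bochner_Integration.integrable_mult_right integrable_divide) auto
    have "(LINT z|\<nu>. H z) = M * ((LINT z|\<nu>. (\<gamma> g z)\<^sup>2) / jbracket g) + M * jbracket g * m"
      unfolding H_def using int[of g] intI intI_eq by simp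
    also have "\<dots> \<le> M * (C * (1 + g\<^sup>2) / jbracket g) + M * jbracket g * m"
      using bd[of g] M by (intro add_right_mono mult_left_mono divide_right_mono) (auto simp: less_imp_le)
    also have "C * (1 + g\<^sup>2) / jbracket g = C * jbracket g"
      unfolding jbracket_square[symmetric] by (simp add: power2_eq_square)
    finally have LH: "(LINT z|\<nu>. H z) \<le> (C + m) * (M * jbracket g)"
      by (simp add: algebra_simps)
    have comp: "v (g + h) t - v g t - h * \<phi>g g t \<le> M * (h\<^sup>2 / jbracket g)" for h
      using barrier_compensated_increment_le[OF M] by (simp add: v slope)
    have "I1 \<nu> \<gamma> \<delta> \<phi> \<phi>g g t \<le> (LINT z|\<nu>. H z)"
      unfolding I1_def set_lebesgue_integral_def
    proof (rule integral_mono'[OF intH _ H0])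
      fix z
      have "\<phi> (g + \<gamma> g z) t - \<phi> g t - \<gamma> g z * \<phi>g g t \<le> M * ((\<gamma> g z)\<^sup>2 / jbracket g)"
        using comp[of "\<gamma> g z"] below[of "g + \<gamma> g z"] touch by linarith
      also have "\<dots> \<le> H z" using M by (simp add: H_def less_imp_le)
      finally show "indicator {z. 0 < \<bar>z\<bar> \<and> \<bar>z\<bar> \<le> \<delta>} z *\<^sub>R
          (\<phi> (g + \<gamma> g z) t - \<phi> g t - \<gamma> g z * \<phi>g g t) \<le> H z"
        using H0[of z] by (simp split: split_indicator)
    qed
    moreover have "I2 \<nu> \<gamma> \<delta> v \<phi>g g t \<le> (LINT z|\<nu>. H z)"
      unfolding I2_def set_lebesgue_integral_def
    proof (rule integral_mono'[OF intH _ H0])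
      fix z
      have "v (g + \<gamma> g z) t - v g t - \<gamma> g z * \<phi>g g t * indicator {z. \<bar>z\<bar> \<le> 1} z \<le> H z"
      proof (cases "\<bar>z\<bar> \<le> 1")
        case True
        then show ?thesis using comp[of "\<gamma> g z"] by (simp add: H_def)
      next
        case False
        then show ?thesis using barrier_increment_le[OF aM, of g "\<gamma> g z"]
          by (simp add: H_def v distrib_left)
      qed
      then show "indicator {z. \<bar>z\<bar> > \<delta>} z *\<^sub>R
          (v (g + \<gamma> g z) t - v g t - \<gamma> g z * \<phi>g g t * indicator {z. \<bar>z\<bar> \<le> 1} z) \<le> H z"
        using H0[of z] by (simp split: split_indicator)
    qed
    ultimately show "I1 \<nu> \<gamma> \<delta> \<phi> \<phi>g g t + I2 \<nu> \<gamma> \<delta> v \<phi>g g t \<le> 2 * (C + m) * (M * jbracket g)"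
      using LH by linarith
  qed
qed

section \<open>The supersolution\<close>

lemma lsc_on_continuous:
  assumes "continuous_on S f"
  shows "lsc_on S f"
  using assms unfolding lsc_on_def continuous_on_def by (auto intro: order_tendstoD)

theorem theorem3p4:
  fixes r \<rho> \<sigma> c L\<gamma> lam \<beta> T :: real
    and \<nu> :: "real measure"
    and \<gamma> :: "real \<Rightarrow> real \<Rightarrow> real"
    and \<alpha> :: "real \<Rightarrow> real"
  assumes "r > 0" and "\<rho> \<ge> 0" and "\<sigma> > 0" and "c > 0"
    and "levy_measure \<nu>"
    and "emeasure \<nu> {z. \<bar>z\<bar> > 1} < \<infinity>"
    and "lam = measure \<nu> {z. \<bar>z\<bar> > 1}"
    and "L\<gamma> > 0"
    and "admissible_jump \<nu> L\<gamma> \<gamma>"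
    and "r + \<rho> < sqrt lam * L\<gamma>"
    and "\<beta> = sqrt lam * L\<gamma> - (r + \<rho>)"
    and "T > 0"
    and "time_profile T \<alpha>"
  shows "\<exists>v. (\<forall>g. \<forall>t\<in>{0..T}. 0 \<le> v g t) \<and> viscosity_supersolution r \<rho> \<sigma> c \<nu> \<gamma> \<alpha> T v"
proof -
  obtain \<alpha>' where \<alpha>'_cont: "continuous_on {0..T} \<alpha>'"
    and \<alpha>_der: "\<And>t. t \<in> {0..T} \<Longrightarrow> (\<alpha> has_real_derivative \<alpha>' t) (at t within {0..T})"
    using \<open>time_profile T \<alpha>\<close> unfolding time_profile_def by blast
  have \<alpha>_cont: "continuous_on {0..T} \<alpha>"
    using \<alpha>_der by (rule DERIV_continuous_on)
  obtain A where A: "\<And>t. t \<in> {0..T} \<Longrightarrow> \<bar>\<alpha> t\<bar> \<le> A"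
    using compact_imp_bounded[OF compact_continuous_image[OF \<alpha>_cont compact_Icc]]
    unfolding bounded_iff by force
  obtain D where D: "\<And>t. t \<in> {0..T} \<Longrightarrow> \<bar>\<alpha>' t\<bar> \<le> D"
    using compact_imp_bounded[OF compact_continuous_image[OF \<alpha>'_cont compact_Icc]]
    unfolding bounded_iff by force
  have AD: "0 \<le> A" "0 \<le> D" using A[of 0] D[of 0] \<open>T > 0\<close> by auto
  obtain C where C: "\<And>\<phi> \<phi>g v M a g t \<delta>.
    \<lbrakk>\<And>x. v x t = barrier M a x; \<And>x. \<phi> x t \<le> v x t; \<phi> g t = v g t;
     \<phi>g g t = M * (g / jbracket g) + a / 2; \<bar>a\<bar> / 2 \<le> M; 0 < \<delta>; \<delta> < 1\<rbrakk>
    \<Longrightarrow> I1 \<nu> \<gamma> \<delta> \<phi> \<phi>g g t + I2 \<nu> \<gamma> \<delta> v \<phi>g g t \<le> C * (M * jbracket g)"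
    using nonlocal_terms_le[OF \<open>levy_measure \<nu>\<close> \<open>emeasure \<nu> {z. \<bar>z\<bar> > 1} < \<infinity>\<close>
        \<open>admissible_jump \<nu> L\<gamma> \<gamma>\<close>] by blast
  \<comment> \<open>The summands absorb, in this order, the derivative of the time profile, the drift, the
    diffusion and the jumps; the maximum with 0 makes the exponential factor at least 1.\<close>
  define B where "B = max 0 (1 + \<rho> + \<sigma>\<^sup>2 / 2 + C)"
  define M where "M t = (A + D + 1) * exp (B * (T - t))" for t
  define v where "v g t = barrier (M t) (\<alpha> t) g" for g t
  have M_ge: "A + D + 1 \<le> M t" if "t \<le> T" for t
    using AD that by (auto simp: M_def B_def)
  have M_der: "(M has_real_derivative - B * M t) (at t within S)" for t S
    unfolding M_def [abs_def] by (auto intro!: derivative_eq_intros)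
  have \<alpha>M: "\<bar>\<alpha> t\<bar> / 2 \<le> M t" if "t \<in> {0..T}" for t
    using A[OF that] M_ge[of t] AD that by auto

  have nonneg: "0 \<le> v g t" if "t \<in> {0..T}" for g t
    unfolding v_def by (intro barrier_nonneg \<alpha>M that)

  have lsc: "lsc_on (UNIV \<times> {0..T}) (\<lambda>(g, t). v g t)"
  proof (rule lsc_on_continuous)
    have "continuous_on (UNIV \<times> {0..T}) (\<lambda>p. \<alpha> (snd p))"
      by (rule continuous_on_compose2[OF \<alpha>_cont]) (auto intro: continuous_intros)
    then show "continuous_on (UNIV \<times> {0..T}) (\<lambda>(g, t). v g t)"
      unfolding v_def barrier_def jbracket_def M_def case_prod_unfold
      by (intro continuous_intros) auto
  qed

  have growth: "\<exists>C>0. \<forall>g. \<forall>t\<in>{0..T}. \<bar>v g t\<bar> \<le> C * (\<bar>g\<bar> + 1)"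
  proof (intro exI[of _ "2 * M 0"] conjI allI ballI)
    show "0 < 2 * M 0" using M_ge[of 0] AD \<open>T > 0\<close> by auto
    fix g t assume t: "t \<in> {0..T}"
    have "M t \<le> M 0" using t AD by (auto simp: M_def B_def intro!: mult_left_mono)
    then have "2 * M t * (\<bar>g\<bar> + 1) \<le> 2 * M 0 * (\<bar>g\<bar> + 1)" by (intro mult_right_mono) auto
    then show "\<bar>v g t\<bar> \<le> 2 * M 0 * (\<bar>g\<bar> + 1)"
      using nonneg[OF t, of g] barrier_le[OF \<alpha>M[OF t], of g] by (simp add: v_def)
  qed

  have touching: "min (- split_op r \<rho> \<sigma> \<nu> \<gamma> \<delta> \<phi> \<phi>t \<phi>g \<phi>gg v g t)
      (v g t - v (- g) t - payoff c \<alpha> g t) \<ge> 0"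
    if C21: "C21 T \<phi> \<phi>t \<phi>g \<phi>gg" and t: "t \<in> {0..<T}"
      and min: "\<And>x s. s \<in> {0..<T} \<Longrightarrow> v g t - \<phi> g t \<le> v x s - \<phi> x s"
      and touch: "v g t = \<phi> g t" and \<delta>: "0 < \<delta>" "\<delta> < 1"
    for \<phi> \<phi>t \<phi>g \<phi>gg g t \<delta>
  proof -
    have t': "t \<in> {0..T}" using t by auto
    have M0: "0 \<le> M t" using \<alpha>M[OF t'] by linarith
    have \<phi>t: "(\<phi> g has_real_derivative \<phi>t g t) (at t within {0..<T})"
      and \<phi>g: "\<And>x. ((\<lambda>x. \<phi> x t) has_real_derivative \<phi>g x t) (at x)"
      and \<phi>gg: "((\<lambda>x. \<phi>g x t) has_real_derivative \<phi>gg g t) (at g)"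
      using C21 t unfolding C21_def by auto
    define w where "w = M t * jbracket g"
    have w: "M t \<le> w" "0 \<le> w"
      using M0 mult_left_mono[OF jbracket_ge_1 M0, of g] by (auto simp: w_def)

    have time: "\<phi>t g t \<le> - B * w + \<alpha>' t / 2 * g"
    proof -
      have "((\<lambda>s. v g s - \<phi> g s) has_real_derivative
          (- B * M t * jbracket g + \<alpha>' t / 2 * g) - \<phi>t g t) (at t within {0..<T})"
        unfolding v_def barrier_def
        by (intro DERIV_diff DERIV_add DERIV_cmult_right DERIV_cdivide M_der \<phi>t
            DERIV_subset[OF \<alpha>_der[OF t']]) auto
      from right_derivative_nonneg_at_min[OF this t] min show ?thesis
        by (simp add: w_def mult.assoc)
    qed
    have diff_der: "((\<lambda>x. v x t - \<phi> x t) has_real_derivative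
        (M t * (x / jbracket x) + \<alpha> t / 2) - \<phi>g x t) (at x)" for x
      unfolding v_def by (intro DERIV_diff barrier_has_derivative \<phi>g)
    have slope: "\<phi>g g t = M t * (g / jbracket g) + \<alpha> t / 2"
      using DERIV_local_min[OF diff_der[of g], of 1] min[OF t] by simp
    have curv: "\<phi>gg g t \<le> w"
    proof -
      have "\<phi>gg g t \<le> M t * (1 / jbracket g ^ 3)"
        using second_derivative_nonneg_at_min[OF diff_der
            DERIV_diff[OF barrier_has_second_derivative \<phi>gg]] min[OF t] by simp
      also have "\<dots> \<le> M t * 1"
        using jbracket_ge_1[of g] by (intro mult_left_mono M0) (simp add: one_le_power)
      finally show ?thesis using w by simp
    qed
    \<comment> \<open>The summand D of the value of M at T is there for this bound.\<close>
    have profile: "\<alpha>' t / 2 * g \<le> w"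
    proof -
      have "\<bar>\<alpha>' t / 2 * g\<bar> \<le> M t * jbracket g"
        unfolding abs_mult using D[OF t'] M_ge[of t] AD t
        by (intro mult_mono abs_le_jbracket) auto
      then show ?thesis unfolding w_def by linarith
    qed
    \<comment> \<open>The even part of the barrier only helps, as the drift points towards the origin.\<close>
    have drift: "- \<rho> * g * \<phi>g g t \<le> \<rho> * w"
    proof -
      have "\<bar>\<alpha> t / 2 * g\<bar> \<le> w"
        unfolding abs_mult w_def using \<alpha>M[OF t'] M0 by (intro mult_mono abs_le_jbracket) auto
      moreover have "0 \<le> M t * (g * (g / jbracket g))"
        using M0 by (simp add: less_imp_le)
      ultimately have "- (g * \<phi>g g t) \<le> w"
        unfolding slope by (simp add: algebra_simps)
      from mult_left_mono[OF this \<open>\<rho> \<ge> 0\<close>] show ?thesis by (simp add: mult.assoc)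
    qed
    have diffusion: "\<sigma>\<^sup>2 / 2 * \<phi>gg g t \<le> \<sigma>\<^sup>2 / 2 * w"
      by (intro mult_left_mono curv) auto
    have discount: "0 \<le> r * v g t" using nonneg[OF t'] \<open>r > 0\<close> by simp
    have jumps: "I1 \<nu> \<gamma> \<delta> \<phi> \<phi>g g t + I2 \<nu> \<gamma> \<delta> v \<phi>g g t \<le> C * w"
      unfolding w_def
      by (rule C[where v=v and a="\<alpha> t"]) (use min[OF t] touch slope \<alpha>M[OF t'] \<delta> in \<open>auto simp: v_def\<close>)
    have "(1 + \<rho> + \<sigma>\<^sup>2 / 2 + C) * w \<le> B * w"
      by (intro mult_right_mono w) (simp add: B_def)
    then have "w + \<rho> * w + \<sigma>\<^sup>2 / 2 * w + C * w \<le> B * w"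
      by (simp add: algebra_simps)
    then have "split_op r \<rho> \<sigma> \<nu> \<gamma> \<delta> \<phi> \<phi>t \<phi>g \<phi>gg v g t \<le> 0"
      unfolding split_op_def using time profile drift diffusion discount jumps by linarith
    moreover have "v g t - v (- g) t - payoff c \<alpha> g t = c"
      unfolding v_def barrier_reflection payoff_def by simp
    ultimately show ?thesis using \<open>c > 0\<close> by simp
  qed

  have "viscosity_supersolution r \<rho> \<sigma> c \<nu> \<gamma> \<alpha> T v"
    unfolding viscosity_supersolution_def
  proof (intro conjI allI impI ballI lsc growth)
    show "0 \<le> v g T" for g using nonneg \<open>T > 0\<close> by simp
  qed (rule touching, auto)
  with nonneg show ?thesis by blast
qed

end
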